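(* Let $\lambda$ be an infinite cardinal. If $G$ is a $(\lambda,\omega)$-limit model in the class of torsion-free abelian groups with the pure subgroup relation, then $G$ is not algebraically compact.
   Context: $H\le_p G$ means $H$ is a pure subgroup of $G$: $H\le G$ and $nG\cap H=nH$ for all $n\in\mathbb{N}$. A pure embedding is an injective homomorphism $f:H\to G$ with $f[H]\le_p G$. For torsion-free $H\le_p G$ with $|G|=|H|=\lambda$, $G$ is universal over $H$ if every torsion-free $H^*$ of cardinality $\lambda$ with $H\le_p H^*$ admits a pure embedding into $G$ fixing $H$ pointwise. $G$ is a $(\lambda,\omega)$-limit model if there is a chain $G_0\le_p G_1\le_p\cdots$ of torsion-free groups of cardinality $\lambda$ with $G_{n+1}$ universal over $G_n$ and $G=\bigcup_n G_n$. A group $G$ is algebraically compact if every countable system of linear equations over $G$ that is finitely solvable in $G$ is solvable in $G$. *)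

theory Defs
  imports "HOL-Algebra.Algebra" "HOL-Library.Countable_Set"
begin

unbundle cardinal_syntax

text \<open>
  Abelian groups are written multiplicatively, as in \<^theory>\<open>HOL-Algebra.Group\<close>: the multiple
  \<open>n x\<close> is \<open>x [^] n\<close>, and \<open>nG\<close> is the image of the carrier under \<open>\<lambda>x. x [^] n\<close>.
  A subgroup \<open>H\<close> of \<open>G\<close> is a set; as a group in its own right it is \<open>G\<lparr>carrier := H\<rparr>\<close>.
\<close>

definition torsion_free_abelian :: "('a, 'b) monoid_scheme \<Rightarrow> bool" where
  "torsion_free_abelian G \<longleftrightarrow> comm_group G \<and>
     (\<forall>x \<in> carrier G. \<forall>n::nat. n > 0 \<longrightarrow> x [^]\<^bsub>G\<^esub> n = \<one>\<^bsub>G\<^esub> \<longrightarrow> x = \<one>\<^bsub>G\<^esub>)"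

definition pure_subgroup :: "'a set \<Rightarrow> ('a, 'b) monoid_scheme \<Rightarrow> bool" where
  "pure_subgroup H G \<longleftrightarrow> subgroup H G \<and>
     (\<forall>n::nat. (\<lambda>x. x [^]\<^bsub>G\<^esub> n) ` carrier G \<inter> H = (\<lambda>x. x [^]\<^bsub>G\<^esub> n) ` H)"

definition pure_embedding ::
    "('a \<Rightarrow> 'c) \<Rightarrow> ('a, 'b) monoid_scheme \<Rightarrow> ('c, 'd) monoid_scheme \<Rightarrow> bool" where
  "pure_embedding f H G \<longleftrightarrow>
     f \<in> hom H G \<and> inj_on f (carrier H) \<and> pure_subgroup (f ` carrier H) G"

text \<open>
  The extensions \<open>Hs\<close> of \<open>H\<close> are given by pure embeddings \<open>f\<close> of \<open>H\<close> rather than by literal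
  inclusions, since the type \<open>'a\<close> need not have room for supersets of \<open>H\<close>; \<open>g\<close> fixing \<open>H\<close>
  pointwise then reads \<open>g (f h) = h\<close>. Quantifying over groups on \<open>'a\<close> is no restriction, because
  \<open>carrier G\<close> already has cardinality \<open>l\<close> (\<open>universal_over_any_type\<close>), and where \<open>'a\<close> has room
  outside \<open>H\<close> this is the same as using literal inclusions only (\<open>universal_over_iff_inclusion\<close>).
\<close>

definition universal_over :: "'c rel \<Rightarrow> 'a set \<Rightarrow> ('a, 'b) monoid_scheme \<Rightarrow> bool" where
  "universal_over l H G \<longleftrightarrow>
     torsion_free_abelian G \<and> pure_subgroup H G \<and> |carrier G| =o l \<and> |H| =o l \<and>
     (\<forall>(Hs :: 'a monoid) f.
        torsion_free_abelian Hs \<and> |carrier Hs| =o l \<and> pure_embedding f (G\<lparr>carrier := H\<rparr>) Hs \<longrightarrow>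
        (\<exists>g. pure_embedding g Hs G \<and> (\<forall>h \<in> H. g (f h) = h)))"

definition omega_limit_model :: "'c rel \<Rightarrow> ('a, 'b) monoid_scheme \<Rightarrow> bool" where
  "omega_limit_model l G \<longleftrightarrow>
     (\<exists>C :: nat \<Rightarrow> 'a set.
        (\<forall>n. torsion_free_abelian (G\<lparr>carrier := C n\<rparr>) \<and> |C n| =o l \<and>
             pure_subgroup (C n) (G\<lparr>carrier := C (Suc n)\<rparr>) \<and>
             universal_over l (C n) (G\<lparr>carrier := C (Suc n)\<rparr>)) \<and>
        carrier G = (\<Union>n. C n))"

text \<open>
  The pair \<open>(c, a)\<close> stands for the equation \<open>\<Sum>j. c j x\<^sub>j = a\<close>. Countably many equations
  involve only countably many unknowns, which are therefore indexed by \<^typ>\<open>nat\<close>.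
\<close>

definition linear_equations :: "('a, 'b) monoid_scheme \<Rightarrow> ((nat \<Rightarrow> int) \<times> 'a) set" where
  "linear_equations G = {(c, a). finite {j. c j \<noteq> 0} \<and> a \<in> carrier G}"

definition solvable_in ::
    "('a, 'b) monoid_scheme \<Rightarrow> ((nat \<Rightarrow> int) \<times> 'a) set \<Rightarrow> bool" where
  "solvable_in G E \<longleftrightarrow>
     (\<exists>x :: nat \<Rightarrow> 'a. (\<forall>j. x j \<in> carrier G) \<and>
        (\<forall>(c, a) \<in> E. (\<Otimes>\<^bsub>G\<^esub>j \<in> {j. c j \<noteq> 0}. x j [^]\<^bsub>G\<^esub> c j) = a))"

definition algebraically_compact :: "('a, 'b) monoid_scheme \<Rightarrow> bool" where
  "algebraically_compact G \<longleftrightarrow>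
     (\<forall>E \<subseteq> linear_equations G.
        countable E \<longrightarrow> (\<forall>F \<subseteq> E. finite F \<longrightarrow> solvable_in G F) \<longrightarrow> solvable_in G E)"

lemma image_group_iso:
  assumes "group G" "inj_on b (carrier G)"
  shows "b \<in> iso G (image_group b G)"
  using assms
  by (auto simp: iso_def hom_def image_group_def bij_betw_def group.is_monoid monoid.m_closed)

lemma torsion_free_abelian_iso:
  assumes t: "torsion_free_abelian G" and i: "b \<in> iso G K" and m: "monoid K"
  shows "torsion_free_abelian K"
proof -
  interpret G: comm_group G using t by (simp add: torsion_free_abelian_def)
  have K: "comm_group K"
    using i m by (intro G.iso_imp_comm_group) (auto simp: is_iso_def)
  then interpret K: comm_group K .
  interpret b: group_hom G K b
    using i by unfold_locales (auto simp: iso_def)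
  have bij: "bij_betw b (carrier G) (carrier K)" using i by (simp add: iso_def)
  have "y = \<one>\<^bsub>K\<^esub>" if y: "y \<in> carrier K" "n > 0" "y [^]\<^bsub>K\<^esub> n = \<one>\<^bsub>K\<^esub>" for y and n :: nat
  proof -
    obtain x where x: "x \<in> carrier G" "y = b x" using y(1) bij by (auto simp: bij_betw_def)
    have "b (x [^]\<^bsub>G\<^esub> n) = b \<one>\<^bsub>G\<^esub>" using x y by (simp add: b.hom_nat_pow)
    then have "x [^]\<^bsub>G\<^esub> n = \<one>\<^bsub>G\<^esub>"
      using bij x by (meson G.nat_pow_closed G.one_closed bij_betw_def inj_onD)
    then have "x = \<one>\<^bsub>G\<^esub>" using t x(1) y(2) by (auto simp: torsion_free_abelian_def)
    then show ?thesis using x(2) by simp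
  qed
  then show ?thesis using K by (auto simp: torsion_free_abelian_def)
qed

lemma pure_embedding_iso:
  assumes "group G" "group K" and i: "b \<in> iso G K"
  shows "pure_embedding b G K"
proof -
  have "b ` carrier G = carrier K" "inj_on b (carrier G)" "b \<in> hom G K"
    using i by (auto simp: iso_def bij_betw_def)
  moreover have "pure_subgroup (carrier K) K"
    using assms(2) by (auto simp: pure_subgroup_def group.subgroup_self group.is_monoid monoid.nat_pow_closed)
  ultimately show ?thesis by (simp add: pure_embedding_def)
qed

lemma pure_embedding_comp:
  assumes G: "group A" "group B" "group C"
    and f: "pure_embedding f A B" and g: "pure_embedding g B C"
  shows "pure_embedding (g \<circ> f) A C"
proof -
  have fh: "f \<in> hom A B" and gh: "g \<in> hom B C" and fi: "inj_on f (carrier A)"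
    and gi: "inj_on g (carrier B)" and fp: "pure_subgroup (f ` carrier A) B"
    and gp: "pure_subgroup (g ` carrier B) C"
    using f g by (auto simp: pure_embedding_def)
  interpret g: group_hom B C g using G gh by (simp add: group_hom_def group_hom_axioms_def)
  have sub: "f ` carrier A \<subseteq> carrier B" using fh by (auto simp: hom_def)
  have h: "g \<circ> f \<in> hom A C" using fh gh by (rule hom_compose)
  have i: "inj_on (g \<circ> f) (carrier A)"
    using fi gi sub by (meson comp_inj_on inj_on_subset)
  have s: "subgroup ((g \<circ> f) ` carrier A) C"
    using G(1,3) h by (intro group_hom.img_is_subgroup) (simp add: group_hom_def group_hom_axioms_def)
  have "(\<lambda>x. x [^]\<^bsub>C\<^esub> n) ` carrier C \<inter> (g \<circ> f) ` carrier A
      = (\<lambda>x. x [^]\<^bsub>C\<^esub> n) ` (g \<circ> f) ` carrier A" for n :: nat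
  proof (intro equalityI subsetI)
    fix z assume z: "z \<in> (\<lambda>x. x [^]\<^bsub>C\<^esub> n) ` carrier C \<inter> (g \<circ> f) ` carrier A"
    then obtain a where a: "a \<in> carrier A" "z = g (f a)" by auto
    have fa: "f a \<in> carrier B" using a sub by auto
    have "z \<in> (\<lambda>x. x [^]\<^bsub>C\<^esub> n) ` g ` carrier B"
      using z a fa gp by (auto simp: pure_subgroup_def)
    then obtain y where y: "y \<in> carrier B" "z = g y [^]\<^bsub>C\<^esub> n" by auto
    have "g (f a) = g (y [^]\<^bsub>B\<^esub> n)" using a y by (simp add: g.hom_nat_pow)
    then have "f a = y [^]\<^bsub>B\<^esub> n" using gi fa y(1) by (auto dest: inj_onD)
    then have "f a \<in> (\<lambda>x. x [^]\<^bsub>B\<^esub> n) ` carrier B \<inter> f ` carrier A"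
      using a(1) y(1) by blast
    then have "f a \<in> (\<lambda>x. x [^]\<^bsub>B\<^esub> n) ` f ` carrier A"
      using fp unfolding pure_subgroup_def by blast
    then obtain a' where "a' \<in> carrier A" "f a = f a' [^]\<^bsub>B\<^esub> n" by auto
    then show "z \<in> (\<lambda>x. x [^]\<^bsub>C\<^esub> n) ` (g \<circ> f) ` carrier A"
      using a sub by (force simp: g.hom_nat_pow)
  next
    fix z assume z: "z \<in> (\<lambda>x. x [^]\<^bsub>C\<^esub> n) ` (g \<circ> f) ` carrier A"
    then obtain a where a: "a \<in> carrier A" "z = g (f a) [^]\<^bsub>C\<^esub> n" by auto
    interpret S: group "C\<lparr>carrier := (g \<circ> f) ` carrier A\<rparr>"
      using s G(3) by (rule subgroup.subgroup_is_group)
    have "z \<in> (g \<circ> f) ` carrier A"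
      using a S.nat_pow_closed[of "g (f a)" n] by (simp add: nat_pow_def)
    moreover have "g (f a) \<in> carrier C" using a sub by auto
    ultimately show "z \<in> (\<lambda>x. x [^]\<^bsub>C\<^esub> n) ` carrier C \<inter> (g \<circ> f) ` carrier A"
      using a by auto
  qed
  then show ?thesis using h i s by (simp add: pure_embedding_def pure_subgroup_def)
qed

lemma torsion_free_abelian_group: "torsion_free_abelian G \<Longrightarrow> group G"
  by (simp add: torsion_free_abelian_def comm_group_def)

lemma image_group_copy:
  fixes Hs :: "('a, 'b) monoid_scheme" and b :: "'a \<Rightarrow> 'c"
  assumes t: "torsion_free_abelian Hs" and i: "inj_on b (carrier Hs)"
  shows "torsion_free_abelian (image_group b Hs)" "pure_embedding b Hs (image_group b Hs)"
    "|carrier (image_group b Hs)| =o |carrier Hs|"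
proof -
  have g: "group Hs" using t by (rule torsion_free_abelian_group)
  interpret group Hs by (rule g)
  have iso: "b \<in> iso Hs (image_group b Hs)" using g i by (rule image_group_iso)
  have m: "monoid (image_group b Hs)"
    using i by (intro monoidI) (auto simp: image_group_def m_assoc)
  show t': "torsion_free_abelian (image_group b Hs)"
    using t iso m by (rule torsion_free_abelian_iso)
  show "pure_embedding b Hs (image_group b Hs)"
    using g torsion_free_abelian_group[OF t'] iso by (rule pure_embedding_iso)
  have "bij_betw b (carrier Hs) (carrier (image_group b Hs))" using iso by (simp add: iso_def)
  then have "|carrier Hs| =o |carrier (image_group b Hs)|"
    using card_of_ordIso by blast
  then show "|carrier (image_group b Hs)| =o |carrier Hs|" by (rule ordIso_symmetric)
qed

lemma universal_over_any_type:
  fixes G :: "('a, 'b) monoid_scheme" and Hs :: "('d, 'e) monoid_scheme"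
  assumes u: "universal_over l H G"
    and t: "torsion_free_abelian Hs" and c: "|carrier Hs| =o l"
    and f: "pure_embedding f (G\<lparr>carrier := H\<rparr>) Hs"
  shows "\<exists>g. pure_embedding g Hs G \<and> (\<forall>h \<in> H. g (f h) = h)"
proof -
  have tG: "torsion_free_abelian G" and sH: "subgroup H G" and cG: "|carrier G| =o l"
    using u by (auto simp: universal_over_def pure_subgroup_def)
  have gG: "group G" and gHs: "group Hs" using tG t by (auto intro: torsion_free_abelian_group)
  have gH: "group (G\<lparr>carrier := H\<rparr>)" using sH gG by (rule subgroup.subgroup_is_group)
  have "|carrier Hs| =o |carrier G|"
    using c cG ordIso_symmetric ordIso_transitive by blast
  then obtain b where "bij_betw b (carrier Hs) (carrier G)" using card_of_ordIso by blast
  then have i: "inj_on b (carrier Hs)" by (simp add: bij_betw_def)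
  define K where "K = image_group b Hs"
  have K: "torsion_free_abelian K" "pure_embedding b Hs K" "|carrier K| =o |carrier Hs|"
    using image_group_copy[OF t i] by (auto simp: K_def)
  have gK: "group K" using K(1) by (rule torsion_free_abelian_group)
  have "pure_embedding (b \<circ> f) (G\<lparr>carrier := H\<rparr>) K"
    using gH gHs gK f K(2) by (rule pure_embedding_comp)
  moreover have "|carrier K| =o l" using K(3) c by (rule ordIso_transitive)
  ultimately obtain g where g: "pure_embedding g K G" "\<forall>h \<in> H. g ((b \<circ> f) h) = h"
    using u K(1) unfolding universal_over_def by blast
  have "pure_embedding (g \<circ> b) Hs G" using gHs gK gG K(2) g(1) by (rule pure_embedding_comp)
  then show ?thesis using g(2) by (intro exI[of _ "g \<circ> b"]) simp
qed

lemma universal_over_iff_inclusion: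
  fixes G :: "('a, 'b) monoid_scheme"
  assumes room: "l \<le>o |- H|"
  shows "universal_over l H G \<longleftrightarrow>
     torsion_free_abelian G \<and> pure_subgroup H G \<and> |carrier G| =o l \<and> |H| =o l \<and>
     (\<forall>Hs :: 'a monoid.
        torsion_free_abelian Hs \<and> |carrier Hs| =o l \<and>
        pure_subgroup H Hs \<and> (\<forall>x \<in> H. \<forall>y \<in> H. x \<otimes>\<^bsub>Hs\<^esub> y = x \<otimes>\<^bsub>G\<^esub> y) \<longrightarrow>
        (\<exists>g. pure_embedding g Hs G \<and> (\<forall>h \<in> H. g h = h)))" (is "?L \<longleftrightarrow> ?R")
proof
  assume L: ?L
  have "\<exists>g. pure_embedding g Hs G \<and> (\<forall>h \<in> H. g h = h)"
    if Hs: "torsion_free_abelian Hs" "|carrier Hs| =o l" "pure_subgroup H Hs"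
      "\<forall>x \<in> H. \<forall>y \<in> H. x \<otimes>\<^bsub>Hs\<^esub> y = x \<otimes>\<^bsub>G\<^esub> y" for Hs :: "'a monoid"
  proof -
    have "H \<subseteq> carrier Hs" using Hs(3) by (auto simp: pure_subgroup_def dest: subgroup.subset)
    then have "pure_embedding (\<lambda>x. x) (G\<lparr>carrier := H\<rparr>) Hs"
      using Hs by (auto simp: pure_embedding_def hom_def)
    from universal_over_any_type[OF L Hs(1,2) this] show ?thesis .
  qed
  then show ?R using L by (simp add: universal_over_def)
next
  assume R: ?R
  have gG: "group G" and sH: "subgroup H G"
    using R by (auto simp: pure_subgroup_def intro: torsion_free_abelian_group)
  have gH: "group (G\<lparr>carrier := H\<rparr>)" using sH gG by (rule subgroup.subgroup_is_group)
  have "\<exists>g. pure_embedding g Hs G \<and> (\<forall>h \<in> H. g (f h) = h)"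
    if Hs: "torsion_free_abelian Hs" "|carrier Hs| =o l" and
      f: "pure_embedding f (G\<lparr>carrier := H\<rparr>) Hs" for Hs :: "'a monoid" and f
  proof -
    have gHs: "group Hs" using Hs(1) by (rule torsion_free_abelian_group)
    have fi: "inj_on f H" using f by (simp add: pure_embedding_def)
    have "|carrier Hs| \<le>o |- H|" using Hs(2) room by (rule ordIso_ordLeq_trans)
    then obtain e where e: "inj_on e (carrier Hs)" "e ` carrier Hs \<subseteq> - H"
      using card_of_ordLeq by metis
    define b where "b y = (if y \<in> f ` H then inv_into H f y else e y)" for y
    have bf: "b (f h) = h" if "h \<in> H" for h using that fi by (simp add: b_def)
    have i: "inj_on b (carrier Hs)"
    proof (rule inj_onI)
      fix x y assume xy: "x \<in> carrier Hs" "y \<in> carrier Hs" "b x = b y"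
      have "b z \<in> H \<longleftrightarrow> z \<in> f ` H" if "z \<in> carrier Hs" for z
        using e(2) that bf by (auto simp: b_def)
      then have "x \<in> f ` H \<longleftrightarrow> y \<in> f ` H" using xy by metis
      then show "x = y" using xy bf e(1) by (cases "x \<in> f ` H") (auto simp: b_def dest: inj_onD)
    qed
    define K where "K = image_group b Hs"
    have K: "torsion_free_abelian K" "pure_embedding b Hs K" "|carrier K| =o |carrier Hs|"
      using image_group_copy[OF Hs(1) i] by (auto simp: K_def)
    have gK: "group K" using K(1) by (rule torsion_free_abelian_group)
    have p: "pure_embedding (b \<circ> f) (G\<lparr>carrier := H\<rparr>) K"
      using gH gHs gK f K(2) by (rule pure_embedding_comp)
    have "(b \<circ> f) ` H = H" using bf by force
    then have "pure_subgroup H K" using p by (simp add: pure_embedding_def)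
    moreover have "x \<otimes>\<^bsub>K\<^esub> y = x \<otimes>\<^bsub>G\<^esub> y" if "x \<in> H" "y \<in> H" for x y
    proof -
      have "(b \<circ> f) (x \<otimes>\<^bsub>G\<^esub> y) = (b \<circ> f) x \<otimes>\<^bsub>K\<^esub> (b \<circ> f) y"
        using p that by (auto simp: pure_embedding_def hom_def)
      then show ?thesis using that bf subgroup.m_closed[OF sH that] by simp
    qed
    moreover have "|carrier K| =o l" using K(3) Hs(2) by (rule ordIso_transitive)
    ultimately obtain g where g: "pure_embedding g K G" "\<forall>h \<in> H. g h = h"
      using R K(1) by blast
    have "pure_embedding (g \<circ> b) Hs G" using gHs gK gG K(2) g(1) by (rule pure_embedding_comp)
    then show ?thesis using g(2) bf by (intro exI[of _ "g \<circ> b"]) simp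
  qed
  then show ?L using R by (simp add: universal_over_def)
qed

lemma omega_limit_model_torsion_free_abelian:
  assumes "omega_limit_model l G"
  shows "torsion_free_abelian G"
proof -
  obtain C where C: "\<And>n. torsion_free_abelian (G\<lparr>carrier := C n\<rparr>)"
      "\<And>n. pure_subgroup (C n) (G\<lparr>carrier := C (Suc n)\<rparr>)" and U: "carrier G = (\<Union>n. C n)"
    using assms by (auto simp: omega_limit_model_def)
  have "C n \<subseteq> C (Suc n)" for n
    using C(2)[of n] subgroup.subset by (fastforce simp: pure_subgroup_def)
  then have mono: "C m \<subseteq> C n" if "m \<le> n" for m n using that by (rule lift_Suc_mono_le)
  have cg: "comm_group (G\<lparr>carrier := C n\<rparr>)" for n
    using C(1) by (simp add: torsion_free_abelian_def)
  have common: "\<exists>n. x \<in> C n \<and> y \<in> C n \<and> z \<in> C n"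
    if xyz: "x \<in> carrier G" "y \<in> carrier G" "z \<in> carrier G" for x y z
  proof -
    obtain i j k where "x \<in> C i" "y \<in> C j" "z \<in> C k" using xyz U by auto
    then have "x \<in> C (i + j + k) \<and> y \<in> C (i + j + k) \<and> z \<in> C (i + j + k)"
      using mono[of i "i + j + k"] mono[of j "i + j + k"] mono[of k "i + j + k"] by auto
    then show ?thesis by blast
  qed
  have local: "x \<otimes>\<^bsub>G\<^esub> y \<in> C n" "\<one>\<^bsub>G\<^esub> \<in> C n" "x \<otimes>\<^bsub>G\<^esub> y = y \<otimes>\<^bsub>G\<^esub> x" "\<one>\<^bsub>G\<^esub> \<otimes>\<^bsub>G\<^esub> x = x"
      "(x \<otimes>\<^bsub>G\<^esub> y) \<otimes>\<^bsub>G\<^esub> z = x \<otimes>\<^bsub>G\<^esub> (y \<otimes>\<^bsub>G\<^esub> z)" "\<exists>w \<in> C n. w \<otimes>\<^bsub>G\<^esub> x = \<one>\<^bsub>G\<^esub>"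
    if "x \<in> C n" "y \<in> C n" "z \<in> C n" for x y z n
  proof -
    interpret N: comm_group "G\<lparr>carrier := C n\<rparr>" by (rule cg)
    show "x \<otimes>\<^bsub>G\<^esub> y \<in> C n" using N.m_closed[of x y] that by simp
    show "\<one>\<^bsub>G\<^esub> \<in> C n" using N.one_closed by simp
    show "x \<otimes>\<^bsub>G\<^esub> y = y \<otimes>\<^bsub>G\<^esub> x" using N.m_comm[of x y] that by simp
    show "\<one>\<^bsub>G\<^esub> \<otimes>\<^bsub>G\<^esub> x = x" using N.l_one[of x] that by simp
    show "(x \<otimes>\<^bsub>G\<^esub> y) \<otimes>\<^bsub>G\<^esub> z = x \<otimes>\<^bsub>G\<^esub> (y \<otimes>\<^bsub>G\<^esub> z)" using N.m_assoc[of x y z] that by simp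
    show "\<exists>w \<in> C n. w \<otimes>\<^bsub>G\<^esub> x = \<one>\<^bsub>G\<^esub>" using N.l_inv_ex[of x] that by simp
  qed
  have one: "\<one>\<^bsub>G\<^esub> \<in> carrier G"
  proof -
    interpret N: comm_group "G\<lparr>carrier := C 0\<rparr>" by (rule cg)
    show ?thesis using N.one_closed U by auto
  qed
  have "comm_group G"
  proof (rule comm_groupI)
    fix x y z assume x: "x \<in> carrier G" and y: "y \<in> carrier G" and z: "z \<in> carrier G"
    obtain n where n: "x \<in> C n" "y \<in> C n" "z \<in> C n" using common[OF x y z] by blast
    show "x \<otimes>\<^bsub>G\<^esub> y \<otimes>\<^bsub>G\<^esub> z = x \<otimes>\<^bsub>G\<^esub> (y \<otimes>\<^bsub>G\<^esub> z)" using local(5)[OF n] .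
  next
    fix x y assume x: "x \<in> carrier G" and y: "y \<in> carrier G"
    obtain n where n: "x \<in> C n" "y \<in> C n" using common[OF x y y] by blast
    show "x \<otimes>\<^bsub>G\<^esub> y \<in> carrier G" using local(1)[OF n n(2)] U by auto
    show "x \<otimes>\<^bsub>G\<^esub> y = y \<otimes>\<^bsub>G\<^esub> x" using local(3)[OF n n(2)] .
  next
    fix x assume x: "x \<in> carrier G"
    obtain n where n: "x \<in> C n" using x U by auto
    show "\<one>\<^bsub>G\<^esub> \<otimes>\<^bsub>G\<^esub> x = x" using local(4)[OF n n n] .
    show "\<exists>y \<in> carrier G. y \<otimes>\<^bsub>G\<^esub> x = \<one>\<^bsub>G\<^esub>" using local(6)[OF n n n] U by auto
  qed (rule one)
  moreover have "x = \<one>\<^bsub>G\<^esub>"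
    if x: "x \<in> carrier G" "n > 0" "x [^]\<^bsub>G\<^esub> n = \<one>\<^bsub>G\<^esub>" for x and n :: nat
  proof -
    obtain k where "x \<in> C k" using x U by auto
    then show ?thesis using C(1)[of k] x(2,3) by (auto simp: torsion_free_abelian_def nat_pow_def)
  qed
  ultimately show ?thesis by (auto simp: torsion_free_abelian_def)
qed

end

theory Submission
  imports Defs
begin

text \<open>
  Write the groups additively. Universality of \<open>C (n + 1)\<close> over \<open>C n\<close>, applied to the extension
  \<open>C n \<oplus> \<int>\<close>, yields \<open>a n \<in> C (n + 1)\<close> lying outside \<open>C n + 2 C (n + 1)\<close>. The system
  \<open>x n - 2 x (n + 1) = a n\<close>, which says that \<open>x 0\<close> is the 2-adic sum of the \<open>2\<^sup>n a n\<close>, is finitely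
  solvable. In a solution, \<open>x 0\<close> lies in some \<open>C k\<close>; purity and torsion-freeness then put
  \<open>x 1, \<dots>, x k\<close> into \<open>C k\<close> as well, and \<open>a k = x k - 2 x (k + 1)\<close> contradicts the choice of \<open>a k\<close>.
\<close>

section \<open>Uniqueness of roots and root-closed subgroups\<close>

lemma torsion_free_abelian_pow_inject:
  assumes "torsion_free_abelian G" "x \<in> carrier G" "y \<in> carrier G"
    and "x [^]\<^bsub>G\<^esub> n = y [^]\<^bsub>G\<^esub> n" "n > (0::nat)"
  shows "x = y"
proof -
  interpret comm_group G using assms(1) by (simp add: torsion_free_abelian_def)
  have "(x \<otimes>\<^bsub>G\<^esub> inv\<^bsub>G\<^esub> y) [^]\<^bsub>G\<^esub> n = \<one>\<^bsub>G\<^esub>"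
    using assms by (simp add: nat_pow_distrib nat_pow_inv)
  then have "x \<otimes>\<^bsub>G\<^esub> inv\<^bsub>G\<^esub> y = \<one>\<^bsub>G\<^esub>"
    using assms unfolding torsion_free_abelian_def by auto
  then show ?thesis using assms by (metis inv_closed inv_equality inv_inv)
qed

text \<open>Purity supplies an \<open>n\<close>-th root of \<open>x [^] n\<close> inside
  \<open>H\<close>, and in a torsion-free group roots are unique, so that root is \<open>x\<close>
  itself.\<close>

lemma pure_subgroup_root_closed:
  assumes t: "torsion_free_abelian G" and p: "pure_subgroup H G"
    and x: "x \<in> carrier G" "x [^]\<^bsub>G\<^esub> n \<in> H" and n: "n > (0::nat)"
  shows "x \<in> H"
proof -
  have "x [^]\<^bsub>G\<^esub> n \<in> (\<lambda>x. x [^]\<^bsub>G\<^esub> n) ` H"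
    using p x unfolding pure_subgroup_def by blast
  then obtain h where h: "h \<in> H" "x [^]\<^bsub>G\<^esub> n = h [^]\<^bsub>G\<^esub> n" by auto
  moreover have "h \<in> carrier G" using p h(1) by (auto simp: pure_subgroup_def dest: subgroup.subset)
  ultimately show ?thesis using torsion_free_abelian_pow_inject[OF t x(1)] n by blast
qed

section \<open>Adjoining a free cyclic summand\<close>

lemma pow_DirProd_int:
  "(x, i) [^]\<^bsub>K \<times>\<times> integer_group\<^esub> (n::nat) = (x [^]\<^bsub>K\<^esub> n, int n * i)"
  by (induction n) (auto simp: algebra_simps)

lemma torsion_free_abelian_DirProd_int:
  assumes "torsion_free_abelian K"
  shows "torsion_free_abelian (K \<times>\<times> integer_group)"
proof -
  interpret K: comm_group K using assms by (simp add: torsion_free_abelian_def)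
  have "group (K \<times>\<times> integer_group)" by (simp add: DirProd_group K.group_axioms)
  then have "comm_group (K \<times>\<times> integer_group)"
    by (rule group.group_comm_groupI) (auto simp: K.m_comm)
  moreover have "x = \<one>\<^bsub>K\<^esub> \<and> i = 0"
    if "x \<in> carrier K" "n > 0" "(x, i) [^]\<^bsub>K \<times>\<times> integer_group\<^esub> n = (\<one>\<^bsub>K\<^esub>, 0)" for x i and n :: nat
    using that assms unfolding pow_DirProd_int torsion_free_abelian_def by simp
  ultimately show ?thesis unfolding torsion_free_abelian_def by simp
qed

text \<open>If \<open>(x, i)\<close> is an \<open>n\<close>-th root of \<open>(h, 0)\<close>, then
  so is \<open>(x, 0)\<close>, which lies in the image. This gives purity for every
  \<open>n\<close>, including 0.\<close>

lemma pure_embedding_DirProd_int: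
  assumes "group K"
  shows "pure_embedding (\<lambda>x. (x, 0)) K (K \<times>\<times> integer_group)"
proof -
  interpret K: group K by fact
  have P: "group (K \<times>\<times> integer_group)" by (simp add: DirProd_group K.group_axioms)
  have h: "(\<lambda>x. (x, 0)) \<in> hom K (K \<times>\<times> integer_group)" by (auto simp: hom_def)
  then have "subgroup ((\<lambda>x. (x, 0)) ` carrier K) (K \<times>\<times> integer_group)"
    using P K.group_axioms
    by (intro group_hom.img_is_subgroup) (simp add: group_hom_def group_hom_axioms_def)
  then show ?thesis
    using h by (auto simp: pure_embedding_def pure_subgroup_def inj_on_def pow_DirProd_int image_iff)
qed

text \<open>Keeps the extension by \<int> at the cardinality that universality demands.\<close>

lemma card_of_Times_int:
  assumes "infinite A"
  shows "|A \<times> (UNIV :: int set)| =o |A|"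
proof -
  have "|UNIV :: int set| \<le>o |UNIV :: nat set|"
    using card_of_ordLeq inj_to_nat by blast
  then have "|UNIV :: int set| \<le>o |A|"
    using assms infinite_iff_card_of_nat ordLeq_transitive by blast
  then show ?thesis using assms card_of_Times_infinite[of A "UNIV :: int set"] by blast
qed

text \<open>Embed \<open>H\<close> \<oplus> \<int> purely into \<open>G\<close> over
  \<open>H\<close> and let \<open>a\<close> be the image of the generator \<open>(0, 1)\<close>. If
  \<open>a = h + 2 v\<close>, then purity of the image gives \<open>v = g (h', m)\<close>, and
  injectivity of \<open>g\<close> turns this into \<open>(- h, 1) = 2 (h', m)\<close>, which fails
  because 1 is odd.\<close>

lemma universal_over_new_coset:
  assumes u: "universal_over l H G" and inf: "infinite H"
  obtains a where "a \<in> carrier G"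
    and "\<And>h v. h \<in> H \<Longrightarrow> v \<in> carrier G \<Longrightarrow> a \<noteq> h \<otimes>\<^bsub>G\<^esub> v [^]\<^bsub>G\<^esub> (2::nat)"
proof -
  let ?K = "G\<lparr>carrier := H\<rparr>"
  let ?P = "?K \<times>\<times> integer_group"
  have t: "torsion_free_abelian G" and s: "subgroup H G" and c: "|H| =o l"
    using u by (auto simp: universal_over_def pure_subgroup_def)
  interpret G: comm_group G using t by (simp add: torsion_free_abelian_def)
  interpret H: subgroup H G by (rule s)
  have gK: "group ?K" using s G.group_axioms by (rule subgroup.subgroup_is_group)
  then have "comm_group ?K" by (rule group.group_comm_groupI) (simp add: G.m_comm)
  then have "torsion_free_abelian ?K"
    using t by (auto simp: torsion_free_abelian_def nat_pow_def)
  then have tP: "torsion_free_abelian ?P" by (rule torsion_free_abelian_DirProd_int)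
  interpret P: group ?P using tP by (rule torsion_free_abelian_group)
  have "|carrier ?P| =o l"
    using card_of_Times_int[OF inf] c ordIso_transitive by auto
  \<comment> \<open>The extension lives on pairs, not on the type of \<open>G\<close>, so
    universality is used in its form for arbitrary types.\<close>
  then obtain g where g: "pure_embedding g ?P G" and fix_H: "\<forall>h \<in> H. g (h, 0) = h"
    using universal_over_any_type[OF u tP _ pure_embedding_DirProd_int[OF gK]] by blast
  have gh: "g \<in> hom ?P G" and gi: "inj_on g (carrier ?P)" and gp: "pure_subgroup (g ` carrier ?P) G"
    using g by (auto simp: pure_embedding_def)
  interpret g: group_hom ?P G g
    using gh by unfold_locales
  let ?a = "g (\<one>\<^bsub>G\<^esub>, 1)"
  have a: "?a \<in> carrier G" by (rule g.hom_closed) simp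
  have "?a \<noteq> h \<otimes>\<^bsub>G\<^esub> v [^]\<^bsub>G\<^esub> (2::nat)" if h: "h \<in> H" and v: "v \<in> carrier G" for h v
  proof
    assume eq: "?a = h \<otimes>\<^bsub>G\<^esub> v [^]\<^bsub>G\<^esub> (2::nat)"
    have i: "inv\<^bsub>G\<^esub> h \<in> H" using h by simp
    \<comment> \<open>Since \<open>g\<close> sends \<open>(h, 0)\<close> to \<open>h\<close> for all
      \<open>h\<close> in \<open>H\<close>, the assumed equation exhibits \<open>2 v\<close> as the
      value of \<open>g\<close> at \<open>(- h, 1)\<close>.\<close>
    have "g (inv\<^bsub>G\<^esub> h, 1) = g ((inv\<^bsub>G\<^esub> h, 0) \<otimes>\<^bsub>?P\<^esub> (\<one>\<^bsub>G\<^esub>, 1))" using i by simp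
    also have "\<dots> = inv\<^bsub>G\<^esub> h \<otimes>\<^bsub>G\<^esub> ?a"
      using i fix_H by (subst g.hom_mult) auto
    also have "\<dots> = v [^]\<^bsub>G\<^esub> (2::nat)"
      using h v by (simp add: eq G.m_assoc[symmetric])
    finally have g_inv: "g (inv\<^bsub>G\<^esub> h, 1) = v [^]\<^bsub>G\<^esub> (2::nat)" .
    have "(inv\<^bsub>G\<^esub> h, 1) \<in> carrier ?P" using i by simp
    then have "v [^]\<^bsub>G\<^esub> (2::nat) \<in> g ` carrier ?P" by (metis g_inv imageI)
    then have "v \<in> g ` carrier ?P" using pure_subgroup_root_closed[OF t gp v] by simp
    then obtain h' m where w: "h' \<in> H" "v = g (h', m)" by auto
    have "g (inv\<^bsub>G\<^esub> h, 1) = g ((h', m) [^]\<^bsub>?P\<^esub> (2::nat))"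
      using w g_inv by (subst g.hom_nat_pow) auto
    moreover have "(h', m) [^]\<^bsub>?P\<^esub> (2::nat) = (h' \<otimes>\<^bsub>G\<^esub> h', m + m)"
      using w by (simp add: numeral_2_eq_2)
    ultimately have "(inv\<^bsub>G\<^esub> h, 1) = (h' \<otimes>\<^bsub>G\<^esub> h', m + m)"
      using gi i w by (auto dest!: inj_onD)
    then have "1 = m + m" by simp
    then show False by presburger
  qed
  then show ?thesis using a that by blast
qed

section \<open>The system of linear equations\<close>

lemma finite_chain_solution:
  assumes "monoid G" and "\<And>n. a n \<in> carrier G"
  shows "\<exists>x. (\<forall>j. x j \<in> carrier G) \<and> (\<forall>n<N. x n = a n \<otimes>\<^bsub>G\<^esub> x (Suc n) [^]\<^bsub>G\<^esub> (2::nat))"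
  using assms(2)
\<comment> \<open>Each unknown is determined by the next one. The induction solves the shifted
  system for \<open>a 1, a 2, \<dots>\<close> and prepends the value that the first equation
  forces.\<close>
proof (induction N arbitrary: a)
  case 0
  then show ?case by blast
next
  case (Suc N)
  interpret monoid G by (rule assms(1))
  obtain x where x: "\<And>j. x j \<in> carrier G"
      "\<And>n. n < N \<Longrightarrow> x n = a (Suc n) \<otimes>\<^bsub>G\<^esub> x (Suc n) [^]\<^bsub>G\<^esub> (2::nat)"
    using Suc.IH[of "a \<circ> Suc"] Suc.prems by auto
  let ?x = "case_nat (a 0 \<otimes>\<^bsub>G\<^esub> x 0 [^]\<^bsub>G\<^esub> (2::nat)) x"
  have "?x j \<in> carrier G" for j using x Suc.prems by (cases j) auto
  moreover have "?x n = a n \<otimes>\<^bsub>G\<^esub> ?x (Suc n) [^]\<^bsub>G\<^esub> (2::nat)" if "n < Suc N" for n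
    using x(2) that by (cases n) auto
  ultimately show ?case by blast
qed

definition chain_coeff :: "nat \<Rightarrow> nat \<Rightarrow> int" where
  "chain_coeff n j = (if j = n then 1 else if j = Suc n then - 2 else 0)"

lemma chain_coeff_support: "{j. chain_coeff n j \<noteq> 0} = {n, Suc n}"
  by (auto simp: chain_coeff_def)

text \<open>Moving the term with coefficient -2 to the other side gives a recursion. It is read
  backwards to solve finite subsystems and forwards to refute the whole system.\<close>

lemma chain_equation_iff:
  assumes "comm_group G" "\<And>j. x j \<in> carrier G" "b \<in> carrier G"
  shows "(\<Otimes>\<^bsub>G\<^esub>j \<in> {j. chain_coeff n j \<noteq> 0}. x j [^]\<^bsub>G\<^esub> chain_coeff n j) = b \<longleftrightarrow>
    x n = b \<otimes>\<^bsub>G\<^esub> x (Suc n) [^]\<^bsub>G\<^esub> (2::nat)"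
proof -
  interpret comm_group G by fact
  have "x (Suc n) [^]\<^bsub>G\<^esub> (- 2 :: int) = inv\<^bsub>G\<^esub> (x (Suc n) [^]\<^bsub>G\<^esub> (2::nat))"
    using int_pow_neg_int[OF assms(2)[of "Suc n"], of 2] by simp
  then have "(\<Otimes>\<^bsub>G\<^esub>j \<in> {j. chain_coeff n j \<noteq> 0}. x j [^]\<^bsub>G\<^esub> chain_coeff n j) =
      x n \<otimes>\<^bsub>G\<^esub> inv\<^bsub>G\<^esub> (x (Suc n) [^]\<^bsub>G\<^esub> (2::nat))"
    unfolding chain_coeff_support using assms(2) by (simp add: chain_coeff_def)
  then show ?thesis using assms inv_solve_right'[of b "x n" "x (Suc n) [^]\<^bsub>G\<^esub> (2::nat)"] by auto
qed

section \<open>The contradiction along the chain\<close>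

theorem theorem4p22:
  fixes G :: "('a, 'b) monoid_scheme" and l :: "'c rel"
  assumes "Card_order l" and "infinite (Field l)"
    and "omega_limit_model l G"
  shows "\<not> algebraically_compact G"
proof
  assume ac: "algebraically_compact G"
  have t: "torsion_free_abelian G" using assms(3) by (rule omega_limit_model_torsion_free_abelian)
  then interpret comm_group G by (simp add: torsion_free_abelian_def)
  obtain C where tC: "\<And>n. torsion_free_abelian (G\<lparr>carrier := C n\<rparr>)" and cC: "\<And>n. |C n| =o l"
      and pC: "\<And>n. pure_subgroup (C n) (G\<lparr>carrier := C (Suc n)\<rparr>)"
      and uC: "\<And>n. universal_over l (C n) (G\<lparr>carrier := C (Suc n)\<rparr>)"
      and U: "carrier G = (\<Union>n. C n)"
    using assms(3) by (auto simp: omega_limit_model_def)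
  have "C n \<subseteq> C (Suc n)" for n
    using pC[of n] subgroup.subset by (fastforce simp: pure_subgroup_def)
  then have mono: "C m \<subseteq> C n" if "m \<le> n" for m n using that by (rule lift_Suc_mono_le)
  have sC: "subgroup (C n) G" for n
    using torsion_free_abelian_group[OF tC] U
    by (intro group_incl_imp_subgroup) auto
  have infC: "infinite (C n)" for n
    using ordIso_finite_Field[OF cC] assms(2) by (simp add: Field_card_of)

  \<comment> \<open>Purity is given only between consecutive members of the chain, so the root
    descends from \<open>C (k + d)\<close> to \<open>C k\<close> one member at a time.\<close>
  have root_step: "y \<in> C k" if "y [^]\<^bsub>G\<^esub> (2::nat) \<in> C k" "y \<in> C (k + d)" for y k d
    using that(2)
  proof (induction d)
    case (Suc d)
    have "y [^]\<^bsub>G\<^esub> (2::nat) \<in> C (k + d)" using that(1) mono[of k "k + d"] by auto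
    then have "y \<in> C (k + d)"
      using Suc.prems pure_subgroup_root_closed[OF tC pC, of y "k + d" 2] by (simp add: nat_pow_def)
    then show ?case by (rule Suc.IH)
  qed simp
  have root: "y \<in> C k" if y: "y [^]\<^bsub>G\<^esub> (2::nat) \<in> C k" "y \<in> carrier G" for y k
  proof -
    obtain m where "y \<in> C m" using y(2) U by auto
    then have "y \<in> C (k + m)" using mono[of m "k + m"] by auto
    then show ?thesis using root_step y(1) by blast
  qed

  \<comment> \<open>Powers do not depend on the carrier of the record, so those taken in
    \<open>C (Suc n)\<close> are powers in \<open>G\<close>. The choice of \<open>a\<close> excludes
    only \<open>v\<close> in \<open>C (Suc n)\<close>; other \<open>v\<close> in \<open>G\<close>
    are dealt with at the end.\<close>
  have "\<exists>a \<in> C (Suc n). \<forall>h \<in> C n. \<forall>v \<in> C (Suc n). a \<noteq> h \<otimes>\<^bsub>G\<^esub> v [^]\<^bsub>G\<^esub> (2::nat)" for n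
    by (rule universal_over_new_coset[OF uC infC]) (auto simp: nat_pow_def)
  then obtain a where a: "\<And>n. a n \<in> C (Suc n)"
      and new: "\<And>n h v. h \<in> C n \<Longrightarrow> v \<in> C (Suc n) \<Longrightarrow> a n \<noteq> h \<otimes>\<^bsub>G\<^esub> v [^]\<^bsub>G\<^esub> (2::nat)"
    by metis
  have aG: "a n \<in> carrier G" for n using a U by auto

  define E where "E = range (\<lambda>n. (chain_coeff n, a n))"
  have "E \<subseteq> linear_equations G"
    using aG by (auto simp: E_def linear_equations_def chain_coeff_support)
  moreover have "countable E" by (simp add: E_def)
  moreover have "solvable_in G F" if F: "F \<subseteq> E" "finite F" for F
  proof -
    \<comment> \<open>A finite subsystem involves finitely many indices. With \<open>N\<close> above
      all of them, a solution of the first \<open>N\<close> equations solves it.\<close>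
    obtain I where I: "finite I" "F = (\<lambda>n. (chain_coeff n, a n)) ` I"
      using finite_subset_image[OF F(2)] F(1) unfolding E_def by metis
    obtain N where N: "\<And>n. n \<in> I \<Longrightarrow> n < N"
      using I(1) finite_nat_iff_bounded by auto
    obtain x where xG: "\<And>j. x j \<in> carrier G"
        and x: "\<And>n. n < N \<Longrightarrow> x n = a n \<otimes>\<^bsub>G\<^esub> x (Suc n) [^]\<^bsub>G\<^esub> (2::nat)"
      using finite_chain_solution[where a = a and N = N, OF monoid_axioms aG] by auto
    have "(\<Otimes>\<^bsub>G\<^esub>j \<in> {j. chain_coeff n j \<noteq> 0}. x j [^]\<^bsub>G\<^esub> chain_coeff n j) = a n"
      if "n \<in> I" for n
      using chain_equation_iff[where x = x, OF comm_group_axioms xG aG] x[OF N[OF that]] by blast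
    then show ?thesis using xG by (auto simp: solvable_in_def I(2))
  qed
  ultimately have "solvable_in G E" using ac by (auto simp: algebraically_compact_def)
  then obtain x where xG: "\<And>j. x j \<in> carrier G"
      and sol: "\<And>n. (\<Otimes>\<^bsub>G\<^esub>j \<in> {j. chain_coeff n j \<noteq> 0}. x j [^]\<^bsub>G\<^esub> chain_coeff n j) = a n"
    by (auto simp: solvable_in_def E_def)
  have x: "x n = a n \<otimes>\<^bsub>G\<^esub> x (Suc n) [^]\<^bsub>G\<^esub> (2::nat)" for n
    using chain_equation_iff[where x = x, OF comm_group_axioms xG aG] sol by blast

  obtain k where k: "x 0 \<in> C k" using xG[of 0] U by auto
  \<comment> \<open>Passing from \<open>x j\<close> to \<open>x (j + 1)\<close> needs
    \<open>a j\<close> in \<open>C k\<close>. As \<open>a j\<close> lies in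
    \<open>C (j + 1)\<close>, this works for \<open>j < k\<close>, and the induction ends exactly at
    \<open>x k\<close>.\<close>
  have "x j \<in> C k" if "j \<le> k" for j
    using that
  proof (induction j)
    case (Suc j)
    then have "a j \<in> C k" using a mono[of "Suc j" k] by auto
    moreover have "x (Suc j) [^]\<^bsub>G\<^esub> (2::nat) = inv\<^bsub>G\<^esub> a j \<otimes>\<^bsub>G\<^esub> x j"
      using aG xG by (subst x[of j]) (simp add: m_assoc[symmetric])
    ultimately have "x (Suc j) [^]\<^bsub>G\<^esub> (2::nat) \<in> C k"
      using Suc by (simp add: subgroup.m_closed[OF sC] subgroup.m_inv_closed[OF sC])
    then show ?case using root xG by blast
  qed (use k in simp)
  then have xk: "x k \<in> C k" by simp
  \<comment> \<open>The sign turns \<open>a k = x k - 2 x (k + 1)\<close> into the form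
    \<open>h + 2 v\<close> that \<open>new\<close> excludes.\<close>
  define v where "v = inv\<^bsub>G\<^esub> x (Suc k)"
  have v: "v \<in> carrier G" using xG by (simp add: v_def)
  have eq: "a k = x k \<otimes>\<^bsub>G\<^esub> v [^]\<^bsub>G\<^esub> (2::nat)"
    using aG xG by (subst x[of k]) (simp add: v_def nat_pow_inv m_assoc)
  \<comment> \<open>To apply \<open>new\<close>, \<open>v\<close> must lie in
    \<open>C (Suc k)\<close>. Both \<open>a k\<close> and \<open>x k\<close> do, hence so does
    \<open>2 v\<close>, and \<open>root\<close> yields \<open>v\<close>.\<close>
  have "v [^]\<^bsub>G\<^esub> (2::nat) = inv\<^bsub>G\<^esub> x k \<otimes>\<^bsub>G\<^esub> a k"
    using xG v by (subst eq) (simp add: m_assoc[symmetric])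
  moreover have "x k \<in> C (Suc k)" using xk mono[of k "Suc k"] by auto
  ultimately have "v [^]\<^bsub>G\<^esub> (2::nat) \<in> C (Suc k)"
    using a by (simp add: subgroup.m_closed[OF sC] subgroup.m_inv_closed[OF sC])
  then have "v \<in> C (Suc k)" using root v by blast
  then show False using new xk eq by blast
qed

end
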